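(* Let $E$ be a real Banach space that is a GL-space. Then $E$ has the Mazur-Ulam property: for every real Banach space $F$ and every surjective isometry $T:S_E\to S_F$, there is a linear isometry $\widetilde T$ from $E$ onto $F$ with $\widetilde T|_{S_E}=T$.
   Context: All spaces are over the real field. $B_E$, $S_E$, $E^*$ denote the closed unit ball, the unit sphere and the dual of $E$. An isometry is a distance-preserving map. A Banach space $E$ is a GL-space (generalized-lush space) if for every $x\in S_E$ and every $\varepsilon>0$ there is $x^*\in S_{E^*}$ such that, with $S=S(x^*,\varepsilon)=\{z\in B_E: x^*(z)>1-\varepsilon\}$, one has $x\in S$ and $\mathrm{dist}(y,S)+\mathrm{dist}(y,-S)<2+\varepsilon$ for all $y\in S_E$. *)

theory Defs
  imports "HOL-Analysis.Analysis"
begin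

definition slice :: "('a::real_normed_vector \<Rightarrow>\<^sub>L real) \<Rightarrow> real \<Rightarrow> 'a set" where
  "slice f \<epsilon> = {z \<in> cball 0 1. blinfun_apply f z > 1 - \<epsilon>}"

text \<open>The argument only carries the space \<^typ>\<open>'a\<close>. The convention that
  \<^const>\<open>infdist\<close> to the empty set is 0 plays no role, since the slice contains \<open>x\<close>.\<close>

definition GL_space :: "'a::banach itself \<Rightarrow> bool" where
  "GL_space _ \<longleftrightarrow>
    (\<forall>x \<in> sphere (0::'a) 1. \<forall>\<epsilon>>0. \<exists>f \<in> sphere (0 :: 'a \<Rightarrow>\<^sub>L real) 1.
       x \<in> slice f \<epsilon> \<and>
       (\<forall>y \<in> sphere 0 1.
          infdist y (slice f \<epsilon>) + infdist y (uminus ` slice f \<epsilon>) < 2 + \<epsilon>))"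

definition isometry_on :: "'a::metric_space set \<Rightarrow> ('a \<Rightarrow> 'b::metric_space) \<Rightarrow> bool" where
  "isometry_on A f \<longleftrightarrow> (\<forall>x\<in>A. \<forall>y\<in>A. dist (f x) (f y) = dist x y)"

end

theory Submission
  imports Defs
begin

text \<open>Up to \<open>\<epsilon>\<close>, a functional \<open>f\<close> given by the GL-property is recovered on the sphere from
  distances to its slice \<open>S\<close>: \<open>f y\<close> is close to \<open>1 - dist(y, S)\<close>.
  A point \<open>u\<close> of \<open>S\<close> and a point \<open>v\<close> of \<open>-S\<close> are almost at distance 2, hence so are
  \<open>T u\<close> and \<open>T v\<close>; comparing with \<open>T x\<close> and \<open>T y\<close> for suitable \<open>u\<close> near \<open>x\<close> and \<open>v\<close> near \<open>y\<close> gives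
  \<open>\<parallel>x - \<lambda> y\<parallel> \<le> \<parallel>T x - \<lambda> T y\<parallel>\<close> for \<open>x, y\<close> on the sphere and \<open>\<lambda> \<ge> 0\<close>.
  So the positively homogeneous extension of \<open>T\<close> does not decrease distances, and as it
  preserves distances on every sphere around 0, a segment argument makes it an isometry.
  It is linear by the Mazur-Ulam theorem.\<close>

lemma isometry_onD:
  assumes "isometry_on A f" "x \<in> A" "y \<in> A"
  shows "norm (f x - f y) = norm (x - y)"
  using assms by (auto simp: isometry_on_def dist_norm)

lemma isometry_on_UNIV_inj: "isometry_on UNIV f \<Longrightarrow> inj f"
  by (rule injI) (metis UNIV_I dist_eq_0_iff isometry_on_def)

section \<open>The Mazur-Ulam theorem\<close>

text \<open>Conjugating the reflection in the midpoint of \<open>f x\<close> and \<open>f y\<close> with \<open>f\<close> gives an isometry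
  swapping \<open>x\<close> and \<open>y\<close> whose defect from preserving the midpoint is twice that of \<open>f\<close>.\<close>

lemma midpoint_defect_double:
  fixes f :: "'a::real_normed_vector \<Rightarrow> 'b::real_normed_vector"
  assumes iso: "isometry_on UNIV f" and "surj f"
  obtains g :: "'a \<Rightarrow> 'a" where "isometry_on UNIV g" "surj g"
    "norm (g (midpoint x y) - midpoint (g x) (g y)) =
     2 * norm (f (midpoint x y) - midpoint (f x) (f y))"
proof -
  define h where "h = inv f"
  define g where "g = (\<lambda>z. h (f x + f y - f z))"
  have fh: "f (h w) = w" for w
    using \<open>surj f\<close> by (simp add: h_def surj_f_inv_f)
  have hf: "h (f z) = z" for z
    using isometry_on_UNIV_inj[OF iso] by (simp add: h_def)
  have nh: "norm (h v - h w) = norm (v - w)" for v w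
    using isometry_onD[OF iso, of "h v" "h w"] by (simp add: fh)
  have "isometry_on UNIV g"
    using isometry_onD[OF iso]
    by (simp add: isometry_on_def g_def dist_norm nh norm_minus_commute)
  moreover have "g (g z) = z" for z
    by (simp add: g_def fh hf)
  then have "surj g"
    by (metis surjI)
  moreover have "norm (g (midpoint x y) - midpoint (g x) (g y)) =
     2 * norm (f (midpoint x y) - midpoint (f x) (f y))"
  proof -
    let ?m = "midpoint x y"
    have "g x = y" "g y = x"
      by (simp_all add: g_def hf)
    then have "norm (g ?m - midpoint (g x) (g y)) = norm (h (f x + f y - f ?m) - h (f ?m))"
      by (simp add: g_def hf midpoint_sym)
    also have "\<dots> = norm (- (2 *\<^sub>R (f ?m - midpoint (f x) (f y))))"
      unfolding nh by (rule arg_cong[where f = norm]) (simp add: midpoint_def algebra_simps scaleR_2)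
    finally show ?thesis
      by simp
  qed
  ultimately show thesis
    by (rule that)
qed

text \<open>This bound does not depend on the isometry, so it survives any number of doublings of
  the defect.\<close>

lemma midpoint_defect_le:
  assumes "isometry_on UNIV f"
  shows "norm (f (midpoint x y) - midpoint (f x) (f y)) \<le> norm (x - y)"
proof -
  let ?m = "midpoint x y"
  have "f ?m - midpoint (f x) (f y) = (1/2) *\<^sub>R (f ?m - f x) + (1/2) *\<^sub>R (f ?m - f y)"
    by (simp add: midpoint_def algebra_simps flip: scaleR_add_left)
  then have "norm (f ?m - midpoint (f x) (f y)) \<le> norm (f ?m - f x) / 2 + norm (f ?m - f y) / 2"
    by (metis (no_types, lifting) norm_triangle_ineq norm_scaleR abs_of_pos half_gt_zero_iff
        mult.commute mult.right_neutral times_divide_eq_right zero_less_one)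
  also have "\<dots> = norm (x - y) / 2"
    using isometry_onD[OF assms, of ?m x] isometry_onD[OF assms, of ?m y]
    by (simp add: dist_midpoint flip: dist_norm)
  finally show ?thesis
    using norm_ge_zero[of "x - y"] by linarith
qed

lemma midpoint_defect_le_power:
  fixes f :: "'a::real_normed_vector \<Rightarrow> 'a"
  assumes "isometry_on UNIV f" "surj f"
  shows "2 ^ n * norm (f (midpoint x y) - midpoint (f x) (f y)) \<le> norm (x - y)"
  using assms
proof (induction n arbitrary: f)
  case 0
  then show ?case
    using midpoint_defect_le[of f x y] by simp
next
  case (Suc n)
  obtain g :: "'a \<Rightarrow> 'a" where g: "isometry_on UNIV g" "surj g"
    "norm (g (midpoint x y) - midpoint (g x) (g y)) =
     2 * norm (f (midpoint x y) - midpoint (f x) (f y))"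
    using midpoint_defect_double[OF Suc.prems] by blast
  show ?case
    using Suc.IH[OF g(1,2)] unfolding g(3) by (simp add: mult.assoc mult.left_commute)
qed

lemma surj_isometry_midpoint:
  fixes f :: "'a::real_normed_vector \<Rightarrow> 'b::real_normed_vector"
  assumes "isometry_on UNIV f" "surj f"
  shows "f (midpoint x y) = midpoint (f x) (f y)"
proof -
  \<comment> \<open>One doubling passes to a self-map of \<open>'a\<close>, for which the doubling
    can be iterated.\<close>
  obtain g :: "'a \<Rightarrow> 'a" where g: "isometry_on UNIV g" "surj g"
    "norm (g (midpoint x y) - midpoint (g x) (g y)) =
     2 * norm (f (midpoint x y) - midpoint (f x) (f y))"
    using midpoint_defect_double[OF assms] by blast
  let ?d = "norm (g (midpoint x y) - midpoint (g x) (g y))"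
  have "?d = 0"
  proof (rule ccontr)
    assume "?d \<noteq> 0"
    then have "?d > 0"
      by simp
    moreover obtain n where "norm (x - y) / ?d < 2 ^ n"
      using real_arch_pow[of 2] by auto
    ultimately have "norm (x - y) < 2 ^ n * ?d"
      by (simp only: pos_divide_less_eq)
    with midpoint_defect_le_power[OF g(1,2), of n x y] show False
      by linarith
  qed
  with g(3) show ?thesis
    by simp
qed

text \<open>Additivity gives homogeneity for naturals, then integers, then rationals by clearing
  denominators; density and continuity give the reals.\<close>

lemma continuous_additive_imp_linear:
  fixes f :: "'a::real_normed_vector \<Rightarrow> 'b::real_normed_vector"
  assumes add: "\<And>x y. f (x + y) = f x + f y" and cont: "continuous_on UNIV f"
  shows "linear f"
proof (rule linearI)
  interpret additive f
    by unfold_locales (rule add)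
  have of_nat: "f (of_nat n *\<^sub>R x) = of_nat n *\<^sub>R f x" for n x
    by (induction n) (simp_all add: zero add scaleR_add_left)
  have of_int: "f (of_int k *\<^sub>R x) = of_int k *\<^sub>R f x" for k x
    by (cases k rule: int_cases2) (simp_all add: of_nat minus)
  have rat: "f (q *\<^sub>R x) - q *\<^sub>R f x = 0" if "q \<in> \<rat>" for q x
  proof -
    from that obtain a b where "b > 0" and q: "q = of_int a / of_int b"
      by (rule Rats_cases')
    then have "of_int b *\<^sub>R f (q *\<^sub>R x) = of_int b *\<^sub>R (q *\<^sub>R f x)"
      by (simp flip: of_int)
    with \<open>b > 0\<close> have "f (q *\<^sub>R x) = q *\<^sub>R f x"
      by (simp only: scaleR_cancel_left) simp
    then show ?thesis
      by simp
  qed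
  show "f (c *\<^sub>R x) = c *\<^sub>R f x" for c x
  proof -
    have "continuous_on (closure \<rat>) (\<lambda>q. f (q *\<^sub>R x) - q *\<^sub>R f x)"
      by (intro continuous_intros continuous_on_compose2[OF cont]) auto
    then have "f (c *\<^sub>R x) - c *\<^sub>R f x = 0"
      by (rule continuous_constant_on_closure) (simp_all add: rat Rats_closure_real)
    then show ?thesis
      by simp
  qed
qed (rule add)

theorem mazur_ulam:
  fixes f :: "'a::real_normed_vector \<Rightarrow> 'b::real_normed_vector"
  assumes iso: "isometry_on UNIV f" and "surj f" and "f 0 = 0"
  shows "linear f"
proof -
  have half: "f ((1/2) *\<^sub>R x) = (1/2) *\<^sub>R f x" for x
    using surj_isometry_midpoint[OF iso \<open>surj f\<close>, of x 0] \<open>f 0 = 0\<close> by (simp add: midpoint_def)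
  have add: "f (x + y) = f x + f y" for x y
    using surj_isometry_midpoint[OF iso \<open>surj f\<close>, of x y]
    by (simp add: midpoint_def half[simplified])
  have "continuous_on UNIV f"
    using iso by (auto simp: continuous_on_iff isometry_on_def)
  with add show ?thesis
    by (rule continuous_additive_imp_linear)
qed

section \<open>Extending isometries between spheres of GL-spaces\<close>

text \<open>As \<open>f\<close> has norm 1 and is below \<open>-1 + \<epsilon>\<close> on
  \<open>-S\<close>, the distance from \<open>y\<close> to \<open>-S\<close> is at least
  \<open>1 + f y - \<epsilon>\<close>. The GL inequality then forces \<open>y\<close> to be close to
  \<open>S\<close>.\<close>

lemma GL_space_sphere_approx:
  fixes x :: "'a::banach"
  assumes "GL_space TYPE('a)" "norm x = 1" "0 < \<epsilon>" "\<epsilon> < 1"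
  obtains f :: "'a \<Rightarrow>\<^sub>L real" where "norm f = 1" "f x > 1 - \<epsilon>"
    "\<And>y. norm y = 1 \<Longrightarrow> \<exists>u. norm u = 1 \<and> f u > 1 - \<epsilon> \<and> norm (y - u) < 1 - f y + 4 * \<epsilon>"
proof -
  obtain f :: "'a \<Rightarrow>\<^sub>L real" where f: "norm f = 1" "x \<in> slice f \<epsilon>" and
    dist: "\<And>y. norm y = 1 \<Longrightarrow> infdist y (slice f \<epsilon>) + infdist y (uminus ` slice f \<epsilon>) < 2 + \<epsilon>"
    using assms unfolding GL_space_def by (fastforce simp: dist_norm)
  have ne: "slice f \<epsilon> \<noteq> {}"
    using f(2) by blast
  have le: "f z \<le> norm z" for z
    using norm_blinfun[of f z] f(1) by simp
  have "\<exists>u. norm u = 1 \<and> f u > 1 - \<epsilon> \<and> norm (y - u) < 1 - f y + 4 * \<epsilon>" if y: "norm y = 1" for y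
  proof -
    have "1 + f y - \<epsilon> \<le> dist y v" if "v \<in> uminus ` slice f \<epsilon>" for v
      using that le[of "y - v"] by (auto simp: slice_def dist_norm blinfun.diff_right blinfun.minus_right blinfun.add_right)
    then have "1 + f y - \<epsilon> \<le> infdist y (uminus ` slice f \<epsilon>)"
      using ne by (auto simp: infdist_notempty intro!: cINF_greatest)
    with dist[OF y] have "infdist y (slice f \<epsilon>) < 1 - f y + 2 * \<epsilon>"
      by linarith
    then obtain w where w: "w \<in> slice f \<epsilon>" "dist y w < 1 - f y + 2 * \<epsilon>"
      using ne by (auto simp: infdist_notempty cINF_less_iff)
    then have fw: "f w > 1 - \<epsilon>" and nw: "norm w \<le> 1" "norm w > 0" "norm w > 1 - \<epsilon>"
      using le[of w] assms by (auto simp: slice_def)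
    \<comment> \<open>Points of the slice may lie inside the ball; normalising \<open>w\<close>
      moves it by less than \<open>\<epsilon>\<close>, and does not decrease \<open>f\<close> since
      \<open>f w > 0\<close>.\<close>
    have "norm (w - sgn w) = \<bar>1 - norm w\<bar>"
    proof -
      have "w - sgn w = (norm w - 1) *\<^sub>R sgn w"
        using nw by (simp add: sgn_div_norm algebra_simps)
      then show ?thesis
        using nw by (simp add: norm_sgn)
    qed
    then have "norm (y - sgn w) < 1 - f y + 4 * \<epsilon>"
      using norm_triangle_ineq[of "y - w" "w - sgn w"] w(2) nw assms by (simp add: dist_norm)
    moreover have "f w \<le> f (sgn w)"
      using nw fw assms by (simp add: sgn_div_norm blinfun.scaleR_right field_simps)
    ultimately show ?thesis
      using fw nw by (intro exI[of _ "sgn w"]) (auto simp: norm_sgn)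
  qed
  with f that show thesis
    by (auto simp: slice_def)
qed

text \<open>The triangle inequality, applied to \<open>a - b\<close> if \<open>r \<le> 1\<close> and
  to \<open>r *\<^sub>R (a - b)\<close> otherwise, loses \<open>\<delta>\<close> or
  \<open>r * \<delta>\<close>; the loss \<open>(1 + r) * \<delta>\<close> covers both cases.\<close>

lemma norm_diff_scaleR_ge:
  fixes a b :: "'a::real_normed_vector"
  assumes "norm a = 1" "norm b = 1" "0 \<le> r" "norm (a - b) \<ge> 2 - \<delta>" "0 \<le> \<delta>"
  shows "norm (a - r *\<^sub>R b) \<ge> (1 + r) * (1 - \<delta>)"
proof (cases "r \<le> 1")
  case True
  have eq: "a - b = (a - r *\<^sub>R b) - (1 - r) *\<^sub>R b"
    by (simp add: algebra_simps)
  have "norm (a - b) \<le> norm (a - r *\<^sub>R b) + (1 - r)"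
    using norm_triangle_ineq4[of "a - r *\<^sub>R b" "(1 - r) *\<^sub>R b", folded eq] True assms by simp
  moreover have "(1 + r) * (1 - \<delta>) \<le> 1 + r - \<delta>"
    using assms by (simp add: algebra_simps)
  ultimately show ?thesis
    using assms by linarith
next
  case False
  have "r *\<^sub>R (a - b) = (a - r *\<^sub>R b) + (r - 1) *\<^sub>R a"
    by (simp add: algebra_simps)
  then have "r * norm (a - b) \<le> norm (a - r *\<^sub>R b) + (r - 1)"
    using norm_triangle_ineq[of "a - r *\<^sub>R b" "(r - 1) *\<^sub>R a"] False assms
    by (metis abs_of_nonneg diff_ge_0_iff_ge linorder_linear mult.right_neutral norm_scaleR)
  moreover have "r * (2 - \<delta>) \<le> r * norm (a - b)"
    using assms by (intro mult_left_mono) auto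
  ultimately show ?thesis
    using assms by (simp add: algebra_simps)
qed

lemma GL_space_sphere_isometry_expands:
  fixes T :: "'a::banach \<Rightarrow> 'b::real_normed_vector"
  assumes GL: "GL_space TYPE('a)"
    and iso: "isometry_on (sphere 0 1) T" and T1: "T ` sphere 0 1 \<subseteq> sphere 0 1"
    and xy: "norm x = 1" "norm y = 1" and "0 \<le> r"
  shows "norm (x - r *\<^sub>R y) \<le> norm (T x - r *\<^sub>R T y)"
proof (cases "x - r *\<^sub>R y = 0")
  case False
  let ?d = "x - r *\<^sub>R y"
  have approx: "norm ?d \<le> norm (T x - r *\<^sub>R T y) + (norm ?d + 6 * (1 + r)) * \<epsilon>"
    if \<epsilon>: "0 < \<epsilon>" "\<epsilon> < 1" for \<epsilon>
  proof -
    \<comment> \<open>The functional is taken at the direction of \<open>?d\<close>, so that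
      \<open>f ?d\<close> almost attains \<open>norm ?d\<close>.\<close>
    obtain f :: "'a \<Rightarrow>\<^sub>L real" where f: "norm f = 1" "f (sgn ?d) > 1 - \<epsilon>"
      and near: "\<And>y. norm y = 1 \<Longrightarrow>
        \<exists>u. norm u = 1 \<and> f u > 1 - \<epsilon> \<and> norm (y - u) < 1 - f y + 4 * \<epsilon>"
      using GL_space_sphere_approx[OF GL _ \<epsilon>, of "sgn ?d"] False by (metis norm_sgn)
    obtain u where u: "norm u = 1" "f u > 1 - \<epsilon>" "norm (x - u) < 1 - f x + 4 * \<epsilon>"
      using near[of x] xy by blast
    \<comment> \<open>The point near \<open>- y\<close> is negated, which puts \<open>v\<close> near
      \<open>y\<close> and in the opposite slice.\<close>
    obtain v where v: "norm v = 1" "f (- v) > 1 - \<epsilon>" "norm (y - v) < 1 + f y + 4 * \<epsilon>"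
      using near[of "- y"] xy
      by (metis (no_types, opaque_lifting) blinfun.minus_right diff_minus_eq_add
          minus_diff_eq minus_minus norm_minus_cancel add.commute diff_minus_eq_add uminus_add_conv_diff)
    have nT: "norm (T z) = 1" if "norm z = 1" for z
      using T1 that by (auto simp: image_subset_iff)
    have dT: "norm (T z - T w) = norm (z - w)" if "norm z = 1" "norm w = 1" for z w
      using isometry_onD[OF iso] that by simp
    have "2 - 2 * \<epsilon> \<le> f (u - v)"
      using u v by (simp add: blinfun.diff_right blinfun.minus_right)
    also have "\<dots> \<le> norm (u - v)"
      using norm_blinfun[of f "u - v"] f(1) by simp
    finally have "(1 + r) * (1 - 2 * \<epsilon>) \<le> norm (T u - r *\<^sub>R T v)"
      using u v \<epsilon> \<open>0 \<le> r\<close> by (intro norm_diff_scaleR_ge) (auto simp: nT dT)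
    also have "\<dots> = norm ((T x - r *\<^sub>R T y) + (T u - T x) + r *\<^sub>R (T y - T v))"
      by (simp add: algebra_simps)
    also have "\<dots> \<le> norm (T x - r *\<^sub>R T y) + norm (T u - T x) + norm (r *\<^sub>R (T y - T v))"
      by (intro norm_triangle_le add_right_mono norm_triangle_ineq)
    also have "\<dots> = norm (T x - r *\<^sub>R T y) + norm (x - u) + r * norm (y - v)"
      using xy u v \<open>0 \<le> r\<close> by (simp add: dT norm_minus_commute)
    also have "\<dots> \<le> norm (T x - r *\<^sub>R T y) + (1 - f x + 4 * \<epsilon>) + r * (1 + f y + 4 * \<epsilon>)"
      using u(3) v(3) \<open>0 \<le> r\<close> by (intro add_mono mult_left_mono) auto
    \<comment> \<open>The terms \<open>1 + r\<close> on both sides cancel; what remains on the left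
      is \<open>f ?d\<close>.\<close>
    finally have "f x - r * f y \<le> norm (T x - r *\<^sub>R T y) + 6 * (1 + r) * \<epsilon>"
      by (simp add: algebra_simps)
    moreover have "norm ?d * (1 - \<epsilon>) \<le> norm ?d * f (sgn ?d)"
      using f(2) by (intro mult_left_mono) auto
    moreover have "norm ?d * f (sgn ?d) = f x - r * f y"
      using False by (simp add: sgn_div_norm blinfun.scaleR_right blinfun.diff_right)
    ultimately show ?thesis
      by (simp add: algebra_simps)
  qed
  have "((\<lambda>\<epsilon>. norm (T x - r *\<^sub>R T y) + (norm ?d + 6 * (1 + r)) * \<epsilon>) \<longlongrightarrow>
      norm (T x - r *\<^sub>R T y) + (norm ?d + 6 * (1 + r)) * 0) (at_right 0)"
    by (intro tendsto_intros)
  moreover have "eventually (\<lambda>\<epsilon>. norm ?d \<le>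
      norm (T x - r *\<^sub>R T y) + (norm ?d + 6 * (1 + r)) * \<epsilon>) (at_right 0)"
    using eventually_at_right_less[of 0] approx
    by (auto simp: eventually_at_right_field intro!: exI[of _ 1])
  ultimately show ?thesis
    using tendsto_lowerbound[OF _ _ trivial_limit_at_right_real] by fastforce
qed simp

lemma extend_to_norm:
  fixes p q :: "'a::real_normed_vector"
  assumes "norm p < norm q"
  obtains t where "1 \<le> t" "norm (q + t *\<^sub>R (p - q)) = norm q"
proof -
  let ?h = "\<lambda>t. norm (q + t *\<^sub>R (p - q))"
  have "norm (p - q) > 0"
    using assms by auto
  \<comment> \<open>For this \<open>s\<close> the point is at distance at least
    \<open>2 * norm q\<close> from \<open>q\<close>, hence not inside the ball of radius
    \<open>norm q\<close>, while \<open>t = 1\<close> gives \<open>p\<close> inside it; continuity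
    does the rest.\<close>
  define s where "s = 1 + 2 * norm q / norm (p - q)"
  have "1 \<le> s"
    by (simp add: s_def)
  have "2 * norm q \<le> s * norm (p - q)"
    using \<open>norm (p - q) > 0\<close> by (simp add: s_def field_simps)
  also have "\<dots> = norm (s *\<^sub>R (p - q))"
    using \<open>1 \<le> s\<close> by simp
  also have "\<dots> \<le> ?h s + norm q"
    using norm_triangle_ineq4[of "q + s *\<^sub>R (p - q)" q] by simp
  finally have "norm q \<le> ?h s"
    by simp
  moreover have "?h 1 \<le> norm q"
    using assms by simp
  moreover have "continuous_on {1..s} ?h"
    by (intro continuous_intros)
  ultimately obtain t where "1 \<le> t" "?h t = norm q"
    using IVT'[of ?h 1 "norm q" s] \<open>1 \<le> s\<close> by auto
  then show thesis
    by (rule that)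
qed

text \<open>The segment from \<open>f b\<close> to \<open>f a\<close> is prolonged to the point \<open>f c\<close> of the sphere through
  \<open>f b\<close>; any expansion of \<open>b - a\<close> would show up in the length of \<open>b - c\<close>, which is preserved.\<close>

lemma expanding_sphere_isometry_isometry:
  fixes f :: "'a::real_normed_vector \<Rightarrow> 'b::real_normed_vector"
  assumes "surj f" and norm: "\<And>x. norm (f x) = norm x"
    and expand: "\<And>x y. norm (x - y) \<le> norm (f x - f y)"
    and sphere: "\<And>x y. norm x = norm y \<Longrightarrow> norm (f x - f y) = norm (x - y)"
  shows "isometry_on UNIV f"
proof -
  have less: "norm (f a - f b) = norm (a - b)" if ab: "norm a < norm b" for a b
  proof -
    obtain t where t: "1 \<le> t" "norm (f b + t *\<^sub>R (f a - f b)) = norm (f b)"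
      using extend_to_norm[of "f a" "f b"] ab by (auto simp: norm)
    obtain c where c: "f c = f b + t *\<^sub>R (f a - f b)"
      using \<open>surj f\<close> by (metis surjD)
    have "norm c = norm b"
      using t(2) by (simp add: norm flip: c)
    have "norm (f c - f b) = t * norm (f a - f b)"
      using t(1) by (simp add: c)
    moreover have "f c - f a = (t - 1) *\<^sub>R (f a - f b)"
      by (simp add: c algebra_simps)
    then have "norm (f c - f a) = (t - 1) * norm (f a - f b)"
      using t(1) by simp
    moreover have "norm (c - b) \<le> norm (c - a) + norm (a - b)"
      using norm_triangle_ineq[of "c - a" "a - b"] by simp
    \<comment> \<open>Since \<open>f a\<close> lies between \<open>f b\<close> and
      \<open>f c\<close>, the two expansion inequalities add up to the reverse of this triangle
      inequality, so both are equalities.\<close>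
    ultimately show ?thesis
      using expand[of c a] expand[of a b] sphere[OF \<open>norm c = norm b\<close>] by (simp add: algebra_simps)
  qed
  have "norm (f a - f b) = norm (a - b)" for a b
    using less[of a b] less[of b a] sphere[of a b]
    by (metis linorder_neqE_linordered_idom norm_minus_commute)
  then show ?thesis
    by (simp add: isometry_on_def dist_norm)
qed

theorem theorem3p2:
  fixes T :: "'a::banach \<Rightarrow> 'b::banach"
  assumes "GL_space TYPE('a)"
    and "isometry_on (sphere 0 1) T"
    and "T ` sphere 0 1 = sphere 0 1"
  shows "\<exists>T' :: 'a \<Rightarrow> 'b. linear T' \<and> isometry_on UNIV T' \<and> surj T' \<and>
           (\<forall>x \<in> sphere 0 1. T' x = T x)"
proof -
  define F where "F x = norm x *\<^sub>R T (sgn x)" for x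
  have F0: "F 0 = 0"
    by (simp add: F_def)
  have nT: "norm (T z) = 1" if "norm z = 1" for z
    using equalityD1[OF assms(3)] that by (auto simp: image_subset_iff)
  have nF: "norm (F x) = norm x" for x
    by (cases "x = 0") (simp_all add: F_def nT norm_sgn)
  have FT: "F x = T x" if "norm x = 1" for x
    using that by (simp add: F_def sgn_div_norm)
  have "surj F"
  proof (rule surjI)
    fix w :: 'b
    \<comment> \<open>For \<open>w = 0\<close> the choice may be arbitrary, because the factor
      \<open>norm w\<close> vanishes.\<close>
    show "F (norm w *\<^sub>R (SOME z. norm z = 1 \<and> T z = sgn w)) = w"
    proof (cases "w = 0")
      case False
      then have "sgn w \<in> T ` sphere 0 1"
        unfolding assms(3) by (simp add: norm_sgn)
      then have "\<exists>z. norm z = 1 \<and> T z = sgn w"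
        by force
      then have "norm (SOME z. norm z = 1 \<and> T z = sgn w) = 1 \<and> T (SOME z. norm z = 1 \<and> T z = sgn w) = sgn w"
        by (rule someI_ex)
      with False show ?thesis
        by (simp add: F_def sgn_div_norm)
    qed (simp add: F0)
  qed
  have expand: "norm (x - y) \<le> norm (F x - F y)" for x y
  proof (cases "x = 0 \<or> y = 0")
    case True
    then show ?thesis
      by (auto simp: F0 nF)
  next
    case False
    \<comment> \<open>Dividing by \<open>norm x\<close> reduces the claim to unit vectors, with the
      ratio of the norms as the scalar.\<close>
    define r where "r = norm y / norm x"
    have "norm (sgn x - r *\<^sub>R sgn y) \<le> norm (T (sgn x) - r *\<^sub>R T (sgn y))"
      using assms False
      by (intro GL_space_sphere_isometry_expands) (auto simp: norm_sgn r_def)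
    then have "norm (norm x *\<^sub>R (sgn x - r *\<^sub>R sgn y))
      \<le> norm (norm x *\<^sub>R (T (sgn x) - r *\<^sub>R T (sgn y)))"
      by (simp add: mult_left_mono)
    then show ?thesis
      using False by (simp add: F_def r_def scaleR_diff_right sgn_div_norm)
  qed
  have sphere: "norm (F x - F y) = norm (x - y)" if "norm x = norm y" for x y
  proof (cases "x = 0")
    case True
    with that show ?thesis
      by (simp add: F0)
  next
    case False
    with that have "y \<noteq> 0"
      by auto
    have "norm (F x - F y) = norm x * norm (T (sgn x) - T (sgn y))"
      using that by (simp add: F_def flip: scaleR_diff_right)
    also have "\<dots> = norm x * norm (sgn x - sgn y)"
      using isometry_onD[OF assms(2), of "sgn x" "sgn y"] False \<open>y \<noteq> 0\<close> by (simp add: norm_sgn)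
    also have "\<dots> = norm (x - y)"
      using False that \<open>y \<noteq> 0\<close> by (simp add: sgn_div_norm flip: scaleR_diff_right)
    finally show ?thesis .
  qed
  have iso: "isometry_on UNIV F"
    using \<open>surj F\<close> nF expand sphere by (rule expanding_sphere_isometry_isometry)
  show ?thesis
    using iso \<open>surj F\<close> mazur_ulam[OF iso \<open>surj F\<close> F0] FT by (intro exI[of _ F]) simp
qed

end
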